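(* Let $A\in\mathbb{R}^{n\times n}$ be nonsingular, $u,v,b\in\mathbb{R}^n$, $B:=A+uv^T$ nonsingular, and let $x$ be the exact solution of $Bx=b$. Assume that the linear systems $Ay=b$ and $Az=u$ are solved normwise backward stably with stability constant $c_s$. Define $$\widetilde c_1:=(n+c_s+2)\frac{\|A\|+\|u\|\|v\|}{\|B\|},\qquad \widetilde c_2:=(2n+2c_s+3)\frac{\|A\|+\|u\|\|v\|}{\|B\|},\qquad c_2:=\frac{\widetilde c_2}{1-\epsilon_M(2\widetilde c_1+c_s)\kappa(B)},$$ and assume that $\epsilon_M(2\widetilde c_1+c_s)\kappa(B)<1$. If $\widehat x$ is computed by the Sherman--Morrison algorithm (SM) in floating point arithmetic with unit roundoff $\epsilon_M$, and $\widehat y$ is the computed solution of $Ay=b$ in that algorithm, then $$\|\widehat x-x\|\le c_2\,\epsilon_M\,\kappa(B)\big(\|\widehat x\|+\|\widehat y\|\big).$$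
   Context: Norms: $\|\cdot\|$ is the Euclidean vector norm and the induced matrix 2-norm; $\kappa(B)=\|B\|\,\|B^{-1}\|$. Algorithm SM (for $(A+uv^T)x=b$): (1) solve $Ay=b$ for $y$; (2) solve $Az=u$ for $z$; (3) compute $\alpha=v^Ty$, $\beta=1+v^Tz$, $\theta=\alpha/\beta$; (4) output $x=y-z\theta$. Hats denote the quantities actually computed in floating point arithmetic. The algorithm runs to completion, so the computed $\widehat\beta$ is nonzero. Floating point model: $\epsilon_M$ is the unit roundoff, $n\epsilon_M<1$, $\gamma_n=n\epsilon_M/(1-n\epsilon_M)$. Every scalar operation satisfies $\mathrm{fl}(a\circ b)=(a\circ b)(1+\delta)$, $|\delta|\le\epsilon_M$, $\circ\in\{+,-,\times,/\}$ (vector operations being performed entrywise). A computed inner product satisfies $\mathrm{fl}(v^Tw)=v^T(I+D)w$ with $D$ diagonal and $|D|\le\gamma_n I$ entrywise. Normwise backward stable solve with (modest) constant $c_s$: for a right-hand side $g$, the computed solution $\widehat s$ of $As=g$ satisfies $(A+\delta A)\widehat s=g+\delta g$ for some $\delta A,\delta g$ (which may differ from solve to solve) with $\|\delta A\|\le c_s\epsilon_M\|A\|$ and $\|\delta g\|\le c_s\epsilon_M\|g\|$. *)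

theory Defs
  imports "HOL-Analysis.Analysis"
begin

(* The norm of the type real^'n^'m is the Frobenius norm; the induced 2-norm is the
   operator norm of the associated linear map. *)
abbreviation norm2 :: "real^'n^'m \<Rightarrow> real" where
  "norm2 M \<equiv> onorm ((*v) M)"

definition cond2 :: "real^'n^'n \<Rightarrow> real" where
  "cond2 M = norm2 M * norm2 (matrix_inv M)"

definition outer_prod :: "real^'m \<Rightarrow> real^'n \<Rightarrow> real^'n^'m" where
  "outer_prod u v = (\<chi> i j. u $ i * v $ j)"

definition gam :: "real \<Rightarrow> nat \<Rightarrow> real" where
  "gam eps n = real n * eps / (1 - real n * eps)"

(* Floating point computations are modelled as relations between exact data and every
   result that the error model allows. *)

definition fl_rounded :: "real \<Rightarrow> real \<Rightarrow> real \<Rightarrow> bool" where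
  "fl_rounded eps r s \<longleftrightarrow> (\<exists>\<delta>. \<bar>\<delta>\<bar> \<le> eps \<and> s = r * (1 + \<delta>))"

definition fl_rounded_vec :: "real \<Rightarrow> real^'n \<Rightarrow> real^'n \<Rightarrow> bool" where
  "fl_rounded_vec eps r s \<longleftrightarrow> (\<forall>i. fl_rounded eps (r $ i) (s $ i))"

definition fl_inner :: "real \<Rightarrow> real^'n \<Rightarrow> real^'n \<Rightarrow> real \<Rightarrow> bool" where
  "fl_inner eps v w s \<longleftrightarrow>
     (\<exists>D :: real^'n^'n.
        (\<forall>i j. i \<noteq> j \<longrightarrow> D $ i $ j = 0) \<and>
        (\<forall>i. \<bar>D $ i $ i\<bar> \<le> gam eps CARD('n)) \<and>
        s = v \<bullet> ((mat 1 + D) *v w))"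

definition backward_stable_solve ::
  "real \<Rightarrow> real \<Rightarrow> real^'n^'n \<Rightarrow> real^'n \<Rightarrow> real^'n \<Rightarrow> bool" where
  "backward_stable_solve eps cs A g s \<longleftrightarrow>
     (\<exists>(\<delta>A :: real^'n^'n) (\<delta>g :: real^'n).
        (A + \<delta>A) *v s = g + \<delta>g \<and>
        norm2 \<delta>A \<le> cs * eps * norm2 A \<and>
        norm \<delta>g \<le> cs * eps * norm g)"

(* Algorithm SM after its two solves, whose computed solutions are yh and zh:
   a = fl(v^T y), s = fl(v^T z), \<beta> = fl(1 + s), \<theta> = fl(a / \<beta>), p = fl(z \<theta>), x = fl(y - p).
   The condition \<beta> \<noteq> 0 says that the algorithm runs to completion. *)
definition SM_combine ::
  "real \<Rightarrow> real^'n \<Rightarrow> real^'n \<Rightarrow> real^'n \<Rightarrow> real^'n \<Rightarrow> bool" where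
  "SM_combine eps v yh zh xh \<longleftrightarrow>
     (\<exists>a s \<beta> \<theta> p.
        fl_inner eps v yh a \<and>
        fl_inner eps v zh s \<and>
        fl_rounded eps (1 + s) \<beta> \<and>
        \<beta> \<noteq> 0 \<and>
        fl_rounded eps (a / \<beta>) \<theta> \<and>
        fl_rounded_vec eps (\<theta> *\<^sub>R zh) p \<and>
        fl_rounded_vec eps (yh - p) xh)"

(* xh is a possible output of Algorithm SM for (A + u v^T) x = b, with yh the computed
   solution of A y = b; both solves are backward stable with constant cs. *)
definition SM_computed ::
  "real \<Rightarrow> real \<Rightarrow> real^'n^'n \<Rightarrow> real^'n \<Rightarrow> real^'n \<Rightarrow> real^'n \<Rightarrow> real^'n \<Rightarrow> real^'n \<Rightarrow> bool" where
  "SM_computed eps cs A u v b yh xh \<longleftrightarrow>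
     (\<exists>zh. backward_stable_solve eps cs A b yh \<and>
           backward_stable_solve eps cs A u zh \<and>
           SM_combine eps v yh zh xh)"

end

(* The computed xh solves the original system up to a residual r: substituting the rounding
   errors of each step into A xh + u (v . xh), the contribution of theta cancels, because
   theta (1 + v . zh) = v . yh holds up to rounding.  What remains of r is of first order in eps,
   and it is bounded in terms of norm xh and norm yh alone: theta zh is close to yh - xh, and theta
   itself is close to v . xh.  The perturbation of b is measured by norm b \<le> norm B * norm x and
   norm x \<le> norm xh + norm (xh - x); the last term accounts for the cs in the denominator of c2,
   whereas the 2 c1 there absorbs all terms of higher order in eps. *)
theory Submission
  imports Defs
begin

section \<open>Operator norms, the rank-one update and the condition number\<close>

lemma norm2_mult_le: "norm (M *v w) \<le> norm2 M * norm w"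
  by (simp add: onorm)

lemma norm2_nonneg: "0 \<le> norm2 M"
  by (simp add: onorm_pos_le)

lemma norm2_add_le: "norm2 (M + N) \<le> norm2 M + norm2 N"
proof -
  have "(*v) (M + N) = (\<lambda>w. M *v w + N *v w)"
    by (simp add: fun_eq_iff matrix_vector_mult_add_rdistrib)
  then show ?thesis
    by (simp add: onorm_triangle)
qed

lemma outer_prod_mult_vec: "outer_prod u v *v w = (v \<bullet> w) *\<^sub>R u"
  by (simp add: outer_prod_def vec_eq_iff matrix_vector_mult_def inner_vec_def
      sum_distrib_left mult_ac)

lemma norm2_outer_prod_le: "norm2 (outer_prod u v) \<le> norm u * norm v"
proof (rule onorm_le)
  fix w
  have "\<bar>v \<bullet> w\<bar> * norm u \<le> (norm v * norm w) * norm u"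
    by (intro mult_right_mono Cauchy_Schwarz_ineq2) auto
  then show "norm (outer_prod u v *v w) \<le> norm u * norm v * norm w"
    by (simp add: outer_prod_mult_vec mult_ac)
qed

lemma matrix_inv_mult_vec:
  fixes M :: "real^'n^'n"
  assumes "invertible M"
  shows "matrix_inv M *v (M *v w) = w"
proof -
  have "matrix_inv M ** M = mat 1"
    using assms unfolding invertible_def matrix_inv_def by (rule someI2_ex) simp
  then show ?thesis
    by (simp add: matrix_vector_mul_assoc)
qed

text \<open>Applying \<open>M\<close> and then its inverse to a unit vector returns that vector. The
  bound lets terms without a condition number be absorbed into terms that carry one.\<close>

lemma cond2_ge_1:
  fixes M :: "real^'n^'n"
  assumes "invertible M"
  shows "1 \<le> cond2 M"
proof -
  obtain w :: "real^'n" where w: "norm w = 1"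
    using vector_choose_size[of 1] by auto
  have "1 = norm (matrix_inv M *v (M *v w))"
    using assms w by (simp add: matrix_inv_mult_vec)
  also have "\<dots> \<le> norm2 (matrix_inv M) * norm (M *v w)"
    by (rule norm2_mult_le)
  also have "\<dots> \<le> norm2 (matrix_inv M) * norm2 M"
    using norm2_mult_le[of M w] w by (intro mult_left_mono norm2_nonneg) auto
  finally show ?thesis
    by (simp add: cond2_def mult.commute)
qed

lemma norm2_pos:
  fixes M :: "real^'n^'n"
  assumes "invertible M"
  shows "0 < norm2 M"
  using cond2_ge_1[OF assms] norm2_nonneg[of M] by (cases "norm2 M = 0") (auto simp: cond2_def)

section \<open>Error bounds for single floating point operations\<close>

lemma norm_le_componentwise_scaled:
  fixes w w' :: "real^'n"
  assumes "\<And>i. \<bar>w' $ i\<bar> \<le> c * \<bar>w $ i\<bar>" "0 \<le> c"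
  shows "norm w' \<le> c * norm w"
proof -
  have "norm w' \<le> norm (c *\<^sub>R w)"
    using assms by (intro norm_le_componentwise_cart) (simp add: abs_mult)
  with assms(2) show ?thesis by simp
qed

lemma fl_rounded_vec_error:
  assumes "fl_rounded_vec eps r s" "0 \<le> eps"
  shows "norm (s - r) \<le> eps * norm r"
proof (rule norm_le_componentwise_scaled)
  fix i
  obtain d where d: "\<bar>d\<bar> \<le> eps" "s $ i = r $ i * (1 + d)"
    using assms(1) unfolding fl_rounded_vec_def fl_rounded_def by blast
  then have "(s - r) $ i = d * r $ i"
    by (simp add: algebra_simps)
  with d(1) show "\<bar>(s - r) $ i\<bar> \<le> eps * \<bar>r $ i\<bar>"
    by (simp add: abs_mult mult_right_mono)
qed (fact assms(2))

text \<open>A diagonal \<open>D\<close> scales each entry of \<open>w\<close> separately, so it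
  contributes at most the factor \<open>gam\<close> in norm; Cauchy-Schwarz then gives the
  claim.\<close>

lemma fl_inner_error:
  fixes v w :: "real^'n"
  assumes "fl_inner eps v w s" "0 \<le> gam eps CARD('n)"
  shows "\<bar>s - v \<bullet> w\<bar> \<le> gam eps CARD('n) * (norm v * norm w)"
proof -
  obtain D :: "real^'n^'n" where off: "\<And>i j. i \<noteq> j \<Longrightarrow> D $ i $ j = 0"
    and diag: "\<And>i. \<bar>D $ i $ i\<bar> \<le> gam eps CARD('n)"
    and s: "s = v \<bullet> ((mat 1 + D) *v w)"
    using assms(1) unfolding fl_inner_def by blast
  have Dw: "(D *v w) $ i = D $ i $ i * w $ i" for i
  proof -
    have "(D *v w) $ i = (\<Sum>j\<in>UNIV. D $ i $ j * w $ j)"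
      by (simp add: matrix_vector_mult_def)
    also have "\<dots> = (\<Sum>j\<in>UNIV. if j = i then D $ i $ i * w $ i else 0)"
      by (intro sum.cong) (auto simp: off)
    finally show ?thesis by simp
  qed
  have "norm (D *v w) \<le> gam eps CARD('n) * norm w"
    using diag assms(2)
    by (intro norm_le_componentwise_scaled) (auto simp: Dw abs_mult mult_right_mono)
  then have "norm v * norm (D *v w) \<le> norm v * (gam eps CARD('n) * norm w)"
    by (intro mult_left_mono) auto
  moreover have "s - v \<bullet> w = v \<bullet> (D *v w)"
    by (simp add: s matrix_vector_mult_add_rdistrib inner_add_right)
  ultimately show ?thesis
    using Cauchy_Schwarz_ineq2[of v "D *v w"] by (simp add: mult_ac)
qed

text \<open>This is a backward view of the division: how well \<open>\<theta>\<close> satisfies its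
  defining equation. No lower bound on \<open>\<beta>\<close> enters, so cancellation in
  \<open>1 + s\<close> does no harm.\<close>

lemma rounded_quotient_error:
  fixes a t \<beta> \<theta> eps :: real
  assumes "fl_rounded eps t \<beta>" "fl_rounded eps (a / \<beta>) \<theta>" "\<beta> \<noteq> 0" "eps < 1"
  shows "\<bar>\<theta> * t - a\<bar> \<le> 2 * eps / (1 - eps) * \<bar>a\<bar>"
proof -
  obtain d1 where d1: "\<bar>d1\<bar> \<le> eps" "\<beta> = t * (1 + d1)"
    using assms(1) unfolding fl_rounded_def by blast
  obtain d2 where d2: "\<bar>d2\<bar> \<le> eps" "\<theta> = a / \<beta> * (1 + d2)"
    using assms(2) unfolding fl_rounded_def by blast
  \<comment> \<open>Multiplying by \<open>1 + d1\<close> turns \<open>t\<close> into the computed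
    \<open>\<beta>\<close>, which cancels against the quotient; only the two relative errors
    remain.\<close>
  have "(\<theta> * t - a) * (1 + d1) = \<theta> * \<beta> - a * (1 + d1)"
    by (simp add: d1(2) algebra_simps)
  also have "\<dots> = a * (d2 - d1)"
    using assms(3) by (simp add: d2(2) field_simps)
  finally have eq: "\<bar>\<theta> * t - a\<bar> * \<bar>1 + d1\<bar> = \<bar>a\<bar> * \<bar>d2 - d1\<bar>"
    by (metis abs_mult)
  have "\<bar>\<theta> * t - a\<bar> * (1 - eps) \<le> \<bar>\<theta> * t - a\<bar> * \<bar>1 + d1\<bar>"
    using d1(1) by (intro mult_left_mono) auto
  also have "\<dots> \<le> \<bar>a\<bar> * (2 * eps)"
    unfolding eq using d1(1) d2(1) by (intro mult_left_mono) auto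
  finally show ?thesis
    using assms(4) by (simp add: field_simps)
qed

section \<open>Scalar estimate collecting all error terms\<close>

text \<open>Here \<open>Z\<close> stands for the norm of \<open>yh - p\<close>, \<open>P\<close> for that of \<open>\<theta> zh\<close>, \<open>t\<close> for \<open>norm u * \<bar>\<theta>\<bar>\<close>,
  and \<open>h\<close> for the errors in the scalar part of the algorithm, multiplied by \<open>norm u\<close>.\<close>

lemma SM_error_terms_le:
  fixes e n c a w \<beta> X Y Z P t h :: real
  assumes pos: "0 < e" "1 \<le> n" "0 \<le> c" "0 \<le> a" "0 \<le> w" "0 \<le> \<beta>" "0 \<le> X" "0 \<le> Y"
    and small: "(n + c + 2) * e < 1"
    and \<beta>: "\<beta> \<le> a + w"
    and Z: "Z \<le> X / (1 - e)"
    and P: "P \<le> (Y + Z) / (1 - e)"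
    and h: "h \<le> n * e / (1 - n * e) * w * (Y + P)
                + 2 * e / (1 - e) * (1 + n * e / (1 - n * e)) * w * Y"
    and t: "t \<le> w * Z + h + w * e * P"
  shows "c * e * (\<beta> * X + a * Y + t + a * P) + e * \<beta> * (P + Z) + h
    \<le> (2 * n + 2 * c + 3) * (a + w) / (1 - (n + c + 2) * e) * e * (X + Y)"
proof -
  have ne0: "0 < n * e" and ce0: "0 \<le> c * e"
    using pos by simp_all
  have sum1: "n * e + c * e + 2 * e < 1"
    using small by (simp add: algebra_simps)
  have e1: "e < 1" and ne1: "n * e < 1"
    using sum1 ne0 ce0 pos(1) by linarith+
  define f where "f = 1 / (1 - e)"
  define k where "k = 1 / (1 - n * e)"
  \<comment> \<open>\<open>K\<close> dominates every product of the factors \<open>f\<close> and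
    \<open>k\<close> that occurs below, so that all bounds can share one amplification
    factor.\<close>
  define K where "K = f * f * k"
  have f1: "1 \<le> f" and k1: "1 \<le> k"
    using e1 ne1 ne0 pos by (auto simp: f_def k_def)
  have f0: "0 \<le> f" and k0: "0 \<le> k"
    using f1 k1 by auto
  have fk: "f \<le> f * k" and ff: "f \<le> f * f" and k_fk: "k \<le> f * k"
    using f1 k1 mult_left_mono[OF k1 f0] mult_left_mono[OF f1 f0] mult_right_mono[OF f1 k0]
    by simp_all
  have fkK: "f * k \<le> K" and ffK: "f * f \<le> K"
    using mult_right_mono[OF ff k0] mult_left_mono[OF k1, of "f * f"] f0 by (auto simp: K_def)
  have fK: "f \<le> K" and kK: "k \<le> K" and K1: "1 \<le> K"
    using fk fkK k_fk f1 by linarith+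
  have Zf: "Z \<le> f * X"
    using Z by (simp add: f_def)
  have Pf: "P \<le> f * Y + f * f * X"
  proof -
    have "P \<le> f * (Y + Z)" using P by (simp add: f_def)
    also have "\<dots> \<le> f * (Y + f * X)" using Zf f0 by (intro mult_left_mono) auto
    finally show ?thesis by (simp add: algebra_simps)
  qed
  have ZK: "Z \<le> K * X"
    using Zf mult_right_mono[OF fK pos(7)] by linarith
  have PK: "P \<le> K * (X + Y)"
    using Pf mult_right_mono[OF fK pos(8)] mult_right_mono[OF ffK pos(7)]
    by (simp add: algebra_simps)
  \<comment> \<open>The sharper \<open>Pf\<close> is needed here: \<open>h\<close> already carries a
    factor \<open>k\<close>, and \<open>k * f * f\<close> is exactly \<open>K\<close>, whereas
    \<open>PK\<close> would lead to \<open>k * K\<close>.\<close>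
  have hK: "h \<le> e * w * K * ((2 * n + 2) * Y + n * X)"
  proof -
    have k_eq: "n * e / (1 - n * e) = n * e * k" "1 + n * e / (1 - n * e) = k"
      using ne1 by (auto simp: k_def field_simps)
    have "h \<le> n * e * k * w * (Y + P) + 2 * e * f * k * w * Y"
      using h unfolding k_eq(2) unfolding k_eq(1) by (simp add: f_def)
    also have "\<dots> \<le> n * e * k * w * (Y + (f * Y + f * f * X)) + 2 * e * f * k * w * Y"
      using Pf ne0 k0 pos by (intro add_right_mono mult_left_mono add_left_mono) auto
    also have "\<dots> = e * w * (n * (k * Y) + (n + 2) * (f * k * Y) + n * (K * X))"
      by (simp add: K_def algebra_simps)
    also have "\<dots> \<le> e * w * (n * (K * Y) + (n + 2) * (K * Y) + n * (K * X))"
      using kK fkK pos by (intro mult_left_mono add_mono mult_right_mono) auto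
    finally show ?thesis by (simp add: algebra_simps)
  qed
  \<comment> \<open>Only \<open>w * X\<close> is of order zero in \<open>e\<close>. As
    \<open>t\<close> enters the claim with the factor \<open>c * e\<close>, everything else in this
    bound is of second order.\<close>
  have tK: "t \<le> K * (w * X + e * w * ((2 * n + 3) * Y + (n + 1) * X))"
  proof -
    have "w * Z \<le> w * (K * X)" "w * e * P \<le> w * e * (K * (X + Y))"
      using ZK PK pos by (auto intro!: mult_left_mono)
    with t hK show ?thesis by (simp add: algebra_simps)
  qed
  have nonneg: "0 \<le> K * X" "0 \<le> K * Y"
    using K1 pos by auto
  have "c * e * (\<beta> * X + a * Y + t + a * P) + e * \<beta> * (P + Z) + h
    \<le> c * e * ((a + w) * (K * X) + a * (K * Y)
        + K * (w * X + e * w * ((2 * n + 3) * Y + (n + 1) * X)) + a * (K * (X + Y)))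
      + e * (a + w) * (K * (X + Y) + K * X) + e * w * K * ((2 * n + 2) * Y + n * X)"
  proof (intro add_mono mult_left_mono[OF _ ce0] tK hK)
    show "\<beta> * X \<le> (a + w) * (K * X)"
      using \<beta> pos mult_right_mono[OF K1 pos(7)] by (intro mult_mono) auto
    show "a * Y \<le> a * (K * Y)"
      using pos mult_right_mono[OF K1 pos(8)] by (intro mult_left_mono) auto
    show "a * P \<le> a * (K * (X + Y))"
      using PK pos by (intro mult_left_mono) auto
    have "e * \<beta> * (P + Z) \<le> e * \<beta> * (K * (X + Y) + K * X)"
      using PK ZK pos by (intro mult_left_mono) auto
    also have "\<dots> \<le> e * (a + w) * (K * (X + Y) + K * X)"
      using \<beta> pos nonneg by (intro mult_right_mono mult_left_mono) (auto simp: distrib_left)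
    finally show "e * \<beta> * (P + Z) \<le> e * (a + w) * (K * (X + Y) + K * X)" .
  qed
  also have "\<dots> \<le> e * (K * (1 + c * e)) * ((2 * n + 2 * c + 3) * (a + w) * (X + Y))"
  proof -
    \<comment> \<open>Comparison of coefficients. To first order \<open>w * Y\<close> collects
      \<open>2 * n + 3\<close>, and each of \<open>a * X\<close>, \<open>a * Y\<close> and
      \<open>w * X\<close> collects \<open>2 * c\<close> plus at most \<open>n + 2\<close>; the
      factor \<open>1 + c * e\<close> makes room for the second-order part of
      \<open>tK\<close>.\<close>
    have XY: "c * ((a + w) * X + a * Y + (w * X + e * w * ((2 * n + 3) * Y + (n + 1) * X)) + a * (X + Y))
      + (a + w) * (X + Y + X) + w * ((2 * n + 2) * Y + n * X)
      \<le> (1 + c * e) * ((2 * n + 2 * c + 3) * (a + w) * (X + Y))" (is "?L \<le> ?R")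
    proof -
      have "?R - ?L = (a * Y) * (2 * n + 2) + (w * Y) * (2 * c)
        + (a * X) * (2 * n + 1) + (w * X) * (n + 1)
        + (c * e) * ((2 * n + 2 * c + 3) * (a * X + a * Y) + 2 * c * (w * Y)
        + (n + 2 * c + 2) * (w * X))"
        by (simp add: algebra_simps)
      also have "\<dots> \<ge> 0"
        using pos by (intro add_nonneg_nonneg mult_nonneg_nonneg) auto
      finally show ?thesis by simp
    qed
    have "0 \<le> e * K" using pos K1 by simp
    from mult_left_mono[OF XY this] show ?thesis
      by (simp add: algebra_simps)
  qed
  also have "\<dots> \<le> e * (1 / (1 - (n + c + 2) * e)) * ((2 * n + 2 * c + 3) * (a + w) * (X + Y))"
  proof -
    \<comment> \<open>The denominator gathers all higher-order factors: \<open>2 * e\<close> comes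
      from \<open>f * f\<close>, \<open>n * e\<close> from \<open>k\<close>, and
      \<open>c * e\<close> from \<open>1 + c * e\<close>.\<close>
    have "(1 + c * e) * (1 - (n + c + 2) * e)
        = 1 - (n + 2) * e - c * e * ((n + c + 2) * e)"
      by (simp add: algebra_simps)
    also have "\<dots> \<le> 1 - (n + 2) * e"
      using ce0 pos by simp
    also have "\<dots> \<le> (1 - e) * (1 - e) * (1 - n * e)"
    proof -
      have "(1 - e) * (1 - e) * (1 - n * e) - (1 - (n + 2) * e)
          = e * e * (1 - n * e) + 2 * (n * e) * e"
        by (simp add: algebra_simps)
      moreover have "0 \<le> e * e * (1 - n * e) + 2 * (n * e) * e"
        using pos ne0 ne1 by simp
      ultimately show ?thesis by linarith
    qed
    finally have "K * ((1 + c * e) * (1 - (n + c + 2) * e))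
        \<le> K * ((1 - e) * (1 - e) * (1 - n * e))"
      using K1 by (intro mult_left_mono) auto
    also have "\<dots> = 1"
      using e1 ne1 by (simp add: K_def f_def k_def)
    finally have "K * (1 + c * e) \<le> 1 / (1 - (n + c + 2) * e)"
      using small by (simp add: pos_le_divide_eq mult.assoc)
    then show ?thesis
      using pos by (intro mult_right_mono mult_left_mono) auto
  qed
  finally show ?thesis by (simp add: mult_ac)
qed

section \<open>Residual of the computed solution\<close>

text \<open>The forward error stays on the right-hand side on purpose: it stems from
  \<open>norm b\<close> and is moved to the left only after multiplication by the inverse of
  \<open>B\<close>.\<close>

lemma SM_residual_le:
  fixes A B :: "real^'n^'n" and u v b x xh yh :: "real^'n" and eps cs :: real
  assumes eps: "0 < eps" and cs: "0 \<le> cs"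
    and small: "(real CARD('n) + cs + 2) * eps < 1"
    and B: "B = A + outer_prod u v"
    and x: "B *v x = b"
    and computed: "SM_computed eps cs A u v b yh xh"
  shows "norm (B *v xh - b) \<le> cs * eps * norm2 B * norm (xh - x)
    + (2 * real CARD('n) + 2 * cs + 3) * (norm2 A + norm u * norm v)
        / (1 - (real CARD('n) + cs + 2) * eps) * eps * (norm xh + norm yh)"
proof -
  obtain zh E1 f1 E2 f2 a s \<beta> \<theta> p where
    sy: "(A + E1) *v yh = b + f1" and E1: "norm2 E1 \<le> cs * eps * norm2 A"
    and f1: "norm f1 \<le> cs * eps * norm b"
    and sz: "(A + E2) *v zh = u + f2" and E2: "norm2 E2 \<le> cs * eps * norm2 A"
    and f2: "norm f2 \<le> cs * eps * norm u"
    and a: "fl_inner eps v yh a" and s: "fl_inner eps v zh s"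
    and \<beta>: "fl_rounded eps (1 + s) \<beta>" "\<beta> \<noteq> 0" and \<theta>: "fl_rounded eps (a / \<beta>) \<theta>"
    and p: "fl_rounded_vec eps (\<theta> *\<^sub>R zh) p" and xh: "fl_rounded_vec eps (yh - p) xh"
    using computed unfolding SM_computed_def backward_stable_solve_def SM_combine_def by blast
  define n where "n = real CARD('n)"
  define g where "g = gam eps CARD('n)"
  define w where "w = norm u * norm v"
  define x' where "x' = yh - p"
  define P where "P = norm (\<theta> *\<^sub>R zh)"
  define d1 where "d1 = a - v \<bullet> yh"
  \<comment> \<open>The factor \<open>\<theta>\<close> is included so that the bound involves
    \<open>P\<close> and not \<open>norm zh\<close>, which cannot be controlled by \<open>xh\<close>
    and \<open>yh\<close> alone.\<close>
  define d2 where "d2 = \<theta> * (s - v \<bullet> zh)"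
  define d3 where "d3 = p - \<theta> *\<^sub>R zh"
  define d4 where "d4 = xh - x'"
  define \<mu> where "\<mu> = \<theta> * (1 + s) - a"
  define h where "h = norm u * \<bar>d1 - d2 + \<mu>\<bar>"
  have n1: "1 \<le> n"
    by (simp add: n_def Suc_leI)
  have "n * eps + cs * eps + 2 * eps < 1"
    using small by (simp add: n_def algebra_simps)
  moreover have "0 \<le> cs * eps" "0 < n * eps"
    using eps cs n1 by auto
  ultimately have eps1: "eps < 1" and neps1: "n * eps < 1"
    using eps by linarith+
  have g: "g = n * eps / (1 - n * eps)"
    by (simp add: g_def gam_def n_def)
  have g0: "0 \<le> g"
    using eps n1 neps1 by (simp add: g)
  have w0: "0 \<le> w"
    by (simp add: w_def)
  have d1: "\<bar>d1\<bar> \<le> g * (norm v * norm yh)"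
    using fl_inner_error[OF a] g0 by (simp add: d1_def g_def)
  have d2: "\<bar>d2\<bar> \<le> g * (norm v * P)"
  proof -
    have "\<bar>\<theta>\<bar> * \<bar>s - v \<bullet> zh\<bar> \<le> \<bar>\<theta>\<bar> * (g * (norm v * norm zh))"
      using fl_inner_error[OF s] g0 by (intro mult_left_mono) (auto simp: g_def)
    then show ?thesis
      by (simp add: d2_def P_def abs_mult mult_ac)
  qed
  have d3: "norm d3 \<le> eps * P"
    using fl_rounded_vec_error[OF p] eps by (simp add: d3_def P_def)
  have d4: "norm d4 \<le> eps * norm x'"
    using fl_rounded_vec_error[OF xh] eps by (simp add: d4_def x'_def)
  have a_le: "\<bar>a\<bar> \<le> (1 + g) * (norm v * norm yh)"
    using d1 Cauchy_Schwarz_ineq2[of v yh] by (simp add: d1_def algebra_simps)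
  have \<mu>: "\<bar>\<mu>\<bar> \<le> 2 * eps / (1 - eps) * ((1 + g) * (norm v * norm yh))"
    using rounded_quotient_error[OF \<beta>(1) \<theta> \<beta>(2) eps1] eps eps1
      mult_left_mono[OF a_le, of "2 * eps / (1 - eps)"]
    by (simp add: \<mu>_def)
  have Z: "norm x' \<le> norm xh / (1 - eps)"
  proof -
    have "norm x' \<le> norm xh + norm d4"
      using norm_triangle_ineq4[of xh d4] by (simp add: d4_def)
    with d4 eps1 show ?thesis by (simp add: field_simps)
  qed
  \<comment> \<open>\<open>\<theta> *\<^sub>R zh\<close> is the difference of \<open>yh\<close> and
    \<open>x'\<close> up to \<open>d3\<close>, and \<open>d3\<close> is itself at most
    \<open>eps * P\<close>, hence absorbed.\<close>
  have P: "P \<le> (norm yh + norm x') / (1 - eps)"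
  proof -
    have "\<theta> *\<^sub>R zh = (yh - x') - d3"
      by (simp add: d3_def x'_def)
    then have "P \<le> norm yh + norm x' + norm d3"
      unfolding P_def using norm_triangle_ineq4[of "yh - x'" d3] norm_triangle_ineq4[of yh x']
      by simp
    with d3 eps1 show ?thesis by (simp add: field_simps)
  qed
  have h: "h \<le> n * eps / (1 - n * eps) * w * (norm yh + P)
      + 2 * eps / (1 - eps) * (1 + n * eps / (1 - n * eps)) * w * norm yh"
  proof -
    have "\<bar>d1 - d2 + \<mu>\<bar> \<le> g * (norm v * norm yh) + g * (norm v * P)
        + 2 * eps / (1 - eps) * ((1 + g) * (norm v * norm yh))"
      using d1 d2 \<mu> by linarith
    from mult_left_mono[OF this, of "norm u"]
    have "h \<le> g * w * (norm yh + P) + 2 * eps / (1 - eps) * (1 + g) * w * norm yh"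
      by (simp add: h_def w_def distrib_left add_divide_distrib mult_ac)
    then show ?thesis by (simp add: g)
  qed
  \<comment> \<open>The exact algorithm satisfies \<open>v \<bullet> x = \<theta>\<close>; this is
    its perturbed form.\<close>
  have vx': "v \<bullet> x' = \<theta> - (d1 - d2 + \<mu>) - v \<bullet> d3"
    by (simp add: x'_def d1_def d2_def d3_def \<mu>_def inner_diff_right algebra_simps)
  have t: "norm u * \<bar>\<theta>\<bar> \<le> w * norm x' + h + w * eps * P"
  proof -
    have "\<bar>\<theta>\<bar> \<le> norm v * norm x' + \<bar>d1 - d2 + \<mu>\<bar> + norm v * norm d3"
      using vx' Cauchy_Schwarz_ineq2[of v x'] Cauchy_Schwarz_ineq2[of v d3] by linarith
    also have "\<dots> \<le> norm v * norm x' + \<bar>d1 - d2 + \<mu>\<bar> + norm v * (eps * P)"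
      using d3 by (intro add_left_mono mult_left_mono) auto
    finally have "norm u * \<bar>\<theta>\<bar>
        \<le> norm u * (norm v * norm x' + \<bar>d1 - d2 + \<mu>\<bar> + norm v * (eps * P))"
      by (intro mult_left_mono) auto
    then show ?thesis
      by (simp add: h_def w_def distrib_left mult_ac)
  qed
  have B_le: "norm2 B \<le> norm2 A + w"
    using norm2_add_le[of A "outer_prod u v"] norm2_outer_prod_le[of u v] by (simp add: B w_def)
  \<comment> \<open>The two solves contribute \<open>- \<theta> *\<^sub>R u\<close> and the rank-one
    part contributes \<open>(v \<bullet> x') *\<^sub>R u\<close>, which cancel up to
    \<open>vx'\<close>. The leftover \<open>v \<bullet> d3\<close> completes \<open>A *v d3\<close>
    to \<open>B *v d3\<close>.\<close>
  have residual: "B *v xh - b = f1 - E1 *v yh - \<theta> *\<^sub>R f2 + E2 *v (\<theta> *\<^sub>R zh)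
      + B *v d4 - B *v d3 - (d1 - d2 + \<mu>) *\<^sub>R u"
  proof -
    have Ay: "A *v yh = b + f1 - E1 *v yh" and Az: "A *v zh = u + f2 - E2 *v zh"
      using sy sz by (simp_all add: matrix_vector_mult_add_rdistrib algebra_simps)
    have Bq: "B *v q = A *v q + (v \<bullet> q) *\<^sub>R u" for q
      by (simp add: B matrix_vector_mult_add_rdistrib outer_prod_mult_vec)
    have "x' = yh - \<theta> *\<^sub>R zh - d3"
      by (simp add: x'_def d3_def)
    then have "A *v x' = A *v yh - \<theta> *\<^sub>R (A *v zh) - A *v d3"
      by (simp add: matrix_vector_mult_diff_distrib matrix_vector_mult_scaleR)
    then have "B *v x' = b + f1 - E1 *v yh - \<theta> *\<^sub>R f2 + E2 *v (\<theta> *\<^sub>R zh) - A *v d3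
        + (v \<bullet> x' - \<theta>) *\<^sub>R u"
      by (simp add: Bq Ay Az matrix_vector_mult_scaleR algebra_simps)
    also have "\<dots> = b + f1 - E1 *v yh - \<theta> *\<^sub>R f2 + E2 *v (\<theta> *\<^sub>R zh) - B *v d3
        - (d1 - d2 + \<mu>) *\<^sub>R u"
      by (simp add: vx' Bq algebra_simps)
    finally have "B *v x' = \<dots>" .
    moreover have "B *v xh = B *v x' + B *v d4"
      by (simp add: d4_def flip: matrix_vector_right_distrib)
    ultimately show ?thesis by simp
  qed
  have f1_le: "norm f1 \<le> cs * eps * (norm2 B * (norm xh + norm (xh - x)))"
  proof -
    have "norm b \<le> norm2 B * norm x"
      using norm2_mult_le[of B x] x by simp
    also have "norm x \<le> norm xh + norm (xh - x)"
      using norm_triangle_ineq4[of xh "xh - x"] by simp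
    finally have "norm b \<le> norm2 B * (norm xh + norm (xh - x))"
      using norm2_nonneg[of B] by (simp add: mult_left_mono)
    then have "cs * eps * norm b \<le> cs * eps * (norm2 B * (norm xh + norm (xh - x)))"
      using cs eps by (intro mult_left_mono) auto
    with f1 show ?thesis by linarith
  qed
  have E1_le: "norm (E1 *v yh) \<le> cs * eps * norm2 A * norm yh"
    using norm2_mult_le[of E1 yh] mult_right_mono[OF E1, of "norm yh"] by simp
  have E2_le: "norm (E2 *v (\<theta> *\<^sub>R zh)) \<le> cs * eps * norm2 A * P"
    using norm2_mult_le[of E2 "\<theta> *\<^sub>R zh"] mult_right_mono[OF E2, of P]
    by (simp add: P_def)
  have f2_le: "norm (\<theta> *\<^sub>R f2) \<le> cs * eps * (norm u * \<bar>\<theta>\<bar>)"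
    using mult_left_mono[OF f2, of "\<bar>\<theta>\<bar>"] by (simp add: mult_ac)
  have Bd3: "norm (B *v d3) \<le> norm2 B * (eps * P)"
    using norm2_mult_le[of B d3] mult_left_mono[OF d3 norm2_nonneg[of B]] by linarith
  have Bd4: "norm (B *v d4) \<le> norm2 B * (eps * norm x')"
    using norm2_mult_le[of B d4] mult_left_mono[OF d4 norm2_nonneg[of B]] by linarith
  have "norm (B *v xh - b) \<le> norm f1 + norm (E1 *v yh) + norm (\<theta> *\<^sub>R f2)
      + norm (E2 *v (\<theta> *\<^sub>R zh)) + norm (B *v d4) + norm (B *v d3)
      + norm ((d1 - d2 + \<mu>) *\<^sub>R u)"
    unfolding residual
    by (intro order_trans[OF norm_triangle_ineq4] order_trans[OF norm_triangle_ineq]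
        add_mono order_refl)
  also have "norm ((d1 - d2 + \<mu>) *\<^sub>R u) = h"
    by (simp add: h_def)
  finally have "norm (B *v xh - b) \<le> cs * eps * (norm2 B * (norm xh + norm (xh - x)))
      + cs * eps * norm2 A * norm yh + cs * eps * (norm u * \<bar>\<theta>\<bar>) + cs * eps * norm2 A * P
      + norm2 B * (eps * norm x') + norm2 B * (eps * P) + h"
    using f1_le E1_le f2_le E2_le Bd3 Bd4 by linarith
  also have "\<dots> = cs * eps * norm2 B * norm (xh - x)
      + (cs * eps * (norm2 B * norm xh + norm2 A * norm yh + norm u * \<bar>\<theta>\<bar> + norm2 A * P)
        + eps * norm2 B * (P + norm x') + h)"
    by (simp add: algebra_simps)
  also have "\<dots> \<le> cs * eps * norm2 B * norm (xh - x)
      + (2 * n + 2 * cs + 3) * (norm2 A + w) / (1 - (n + cs + 2) * eps) * eps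
        * (norm xh + norm yh)"
    \<comment> \<open>In \<open>SM_error_terms_le\<close> the variables \<open>a\<close> and
      \<open>\<beta>\<close> become \<open>norm2 A\<close> and \<open>norm2 B\<close>, not the
      computed scalars of the same names.\<close>
    using small
    by (intro add_left_mono SM_error_terms_le[OF eps n1 cs norm2_nonneg w0 norm2_nonneg
          norm_ge_zero norm_ge_zero _ B_le Z P h t]) (simp add: n_def)
  finally show ?thesis
    by (simp add: n_def w_def)
qed

section \<open>From the residual to the forward error\<close>

theorem theorem2p4:
  fixes A B :: "real^'n^'n"
    and u v b x xh yh :: "real^'n"
    and eps cs c1t c2t c2 :: real
  assumes eps_pos: "0 < eps"
    and eps_small: "real CARD('n) * eps < 1"
    and A_nonsingular: "invertible A"
    and B_eq: "B = A + outer_prod u v"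
    and B_nonsingular: "invertible B"
    and x_exact: "B *v x = b"
    and c1t_eq: "c1t = (real CARD('n) + cs + 2) * ((norm2 A + norm u * norm v) / norm2 B)"
    and c2t_eq: "c2t = (2 * real CARD('n) + 2 * cs + 3) * ((norm2 A + norm u * norm v) / norm2 B)"
    and c2_eq: "c2 = c2t / (1 - eps * (2 * c1t + cs) * cond2 B)"
    and not_too_ill: "eps * (2 * c1t + cs) * cond2 B < 1"
    and computed: "SM_computed eps cs A u v b yh xh"
  shows "norm (xh - x) \<le> c2 * eps * cond2 B * (norm xh + norm yh)"
proof -
  define \<rho> where "\<rho> = (norm2 A + norm u * norm v) / norm2 B"
  define M where "M = real CARD('n) + cs + 2"
  define err where "err = norm (xh - x)"
  have B0: "0 < norm2 B"
    by (rule norm2_pos[OF B_nonsingular])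
  have \<kappa>1: "1 \<le> cond2 B"
    by (rule cond2_ge_1[OF B_nonsingular])
  \<comment> \<open>The backward error bound forces the sign of \<open>cs\<close>: an operator norm
    is nonnegative, and \<open>norm2 A\<close> is positive because \<open>A\<close> is
    invertible.\<close>
  have cs0: "0 \<le> cs"
  proof -
    obtain E :: "real^'n^'n" where "norm2 E \<le> cs * eps * norm2 A"
      using computed unfolding SM_computed_def backward_stable_solve_def by blast
    then have "0 \<le> cs * (eps * norm2 A)"
      using norm2_nonneg[of E] by (simp add: mult.assoc)
    moreover have "0 < eps * norm2 A"
      using eps_pos norm2_pos[OF A_nonsingular] by simp
    ultimately show ?thesis
      by (simp add: zero_le_mult_iff)
  qed
  have M0: "0 \<le> M"
    using cs0 by (simp add: M_def)
  have \<rho>1: "1 \<le> \<rho>"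
    using norm2_add_le[of A "outer_prod u v"] norm2_outer_prod_le[of u v] B0
    by (simp add: \<rho>_def B_eq)
  have \<rho>\<kappa>: "1 \<le> \<rho> * cond2 B"
    using mult_mono[OF \<rho>1 \<kappa>1] \<rho>1 by simp
  have M_eps0: "0 \<le> M * eps"
    using M0 eps_pos by simp
  \<comment> \<open>Since \<open>\<rho> * cond2 B\<close> is at least 1, the conditioning hypothesis
    also yields the smallness condition of \<open>SM_residual_le\<close>.\<close>
  have M_eps: "M * eps \<le> eps * (2 * c1t) * cond2 B"
  proof -
    have "M * eps * 1 \<le> M * eps * (\<rho> * cond2 B)"
      by (rule mult_left_mono[OF \<rho>\<kappa> M_eps0])
    moreover have "eps * (2 * c1t) * cond2 B = 2 * (M * eps * (\<rho> * cond2 B))"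
      by (simp add: c1t_eq M_def \<rho>_def)
    ultimately show ?thesis
      using M_eps0 by linarith
  qed
  define C where "C = cs * eps * cond2 B"
  have C0: "0 \<le> C"
    using cs0 eps_pos \<kappa>1 by (simp add: C_def)
  define d where "d = 1 - eps * (2 * c1t + cs) * cond2 B"
  have d0: "0 < d"
    using not_too_ill by (simp add: d_def)
  have d_eq: "d = 1 - eps * (2 * c1t) * cond2 B - C"
    by (simp add: d_def C_def algebra_simps)
  have small: "M * eps < 1" and C1: "C < 1"
    using d0 d_eq M_eps M_eps0 C0 by linarith+
  \<comment> \<open>The denominators \<open>1 - C\<close>, from the feedback of the error, and
    \<open>1 - M * eps\<close>, from higher-order terms, merge into the single denominator of
    \<open>c2\<close>.\<close>
  have d_le: "d \<le> (1 - C) * (1 - M * eps)"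
    using d_eq M_eps mult_nonneg_nonneg[OF C0 M_eps0] by (simp add: algebra_simps)
  have c2t: "c2t = (2 * real CARD('n) + 2 * cs + 3) * \<rho>"
    by (simp add: c2t_eq \<rho>_def)
  define R where "R = c2t * eps * cond2 B * (norm xh + norm yh)"
  have "err = norm (matrix_inv B *v (B *v xh - b))"
    using matrix_inv_mult_vec[OF B_nonsingular, of "xh - x"] x_exact
    by (simp add: err_def matrix_vector_mult_diff_distrib)
  also have "\<dots> \<le> norm2 (matrix_inv B) * norm (B *v xh - b)"
    by (rule norm2_mult_le)
  also have "\<dots> \<le> norm2 (matrix_inv B) * (cs * eps * norm2 B * err
      + (2 * real CARD('n) + 2 * cs + 3) * (norm2 A + norm u * norm v)
          / (1 - M * eps) * eps * (norm xh + norm yh))"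
    using SM_residual_le[OF eps_pos cs0 _ B_eq x_exact computed] small
    by (intro mult_left_mono norm2_nonneg) (simp add: M_def err_def)
  also have "\<dots> = C * err + R / (1 - M * eps)"
  proof -
    have "norm2 A + norm u * norm v = \<rho> * norm2 B"
      using B0 by (simp add: \<rho>_def)
    then show ?thesis
      by (simp add: C_def R_def c2t cond2_def distrib_left mult_ac)
  qed
  finally have "err * (1 - C) \<le> R / (1 - M * eps)"
    by (simp add: algebra_simps)
  then have "err * ((1 - C) * (1 - M * eps)) \<le> R"
    using small by (simp add: pos_le_divide_eq mult.assoc)
  moreover have "err * d \<le> err * ((1 - C) * (1 - M * eps))"
    using d_le by (intro mult_left_mono) (auto simp: err_def)
  ultimately have "err \<le> R / d"
    using d0 by (simp add: pos_le_divide_eq)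
  then show ?thesis
    by (simp add: err_def R_def c2_eq d_def)
qed

end
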